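(* The packing LP and the compact edge-flow LP of an ANF instance (both defined in the context) are equivalent in the following sense: given a feasible solution to one of the two LPs, one can obtain a feasible solution to the other LP of the same objective value. That is, for every feasible solution of the compact edge-flow LP there is a feasible solution of the packing LP with the same value, and for every feasible solution of the packing LP there is a feasible solution of the compact edge-flow LP with the same value.
   Context: An instance of the all-or-nothing multicommodity flow (ANF) problem consists of a directed graph $G=(V,E)$ with edge capacities $c(e)>0$ and $k$ commodities, i.e. source-destination pairs $(s_i,t_i)$ with $s_i,t_i\in V$, with demands $d_i>0$ and weights $w_i>0$, $i\in[k]=\{1,\dots,k\}$. A valid flow for commodity $i$ is a function $f:E\to\mathbb{R}_{\ge0}$ that routes $d_i$ units of flow from $s_i$ to $t_i$ in $G$ (with flow conservation at every $v\ne s_i,t_i$) and respects the edge capacities, $f(e)\le c(e)$ for all $e\in E$. $\mathcal F_i$ is the set of all valid flows for commodity $i$. Packing LP (variables $y(f)$ for $f\in\mathcal F_i$, $i\in[k]$, only finitely many of them nonzero): maximize $\sum_{i=1}^k w_i\sum_{f\in\mathcal F_i}y(f)$ subject to $\sum_{f\in\mathcal F_i}y(f)\le 1$ for all $i\in[k]$; $\sum_{i=1}^k\sum_{f\in\mathcal F_i}f(e)\,y(f)\le c(e)$ for all $e\in E$; $y(f)\ge0$ for all $f\in\mathcal F_i$, $i\in[k]$. Compact edge-flow LP (the LP relaxation of the compact edge-flow mixed integer program, obtained by letting each $f_i$ take any real value in $[0,1]$ instead of $\{0,1\}$; variables $f_i$, $i\in[k]$, and $f_{i,e}$, $i\in[k]$,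 $e\in E$): maximize $\sum_{i=1}^k w_if_i$ subject to (1) $\sum_{(s_i,v)\in E}f_{i,(s_i,v)}=f_i$ for all $i\in[k]$; (2) $\sum_{(u,v)\in E}f_{i,(u,v)}=\sum_{(v,u)\in E}f_{i,(v,u)}$ for all $i\in[k]$ and all $v\in V\setminus\{s_i,t_i\}$; (3) $\sum_{i=1}^k f_{i,e}\,d_i\le c(e)$ for all $e\in E$; (4) $f_{i,e}\,d_i\le f_i\,c(e)$ for all $i\in[k]$, $e\in E$; (5) $f_{i,e}\ge0$ for all $i\in[k]$, $e\in E$, and $f_i\in[0,1]$ for all $i\in[k]$.
   Formalization: A valid flow is taken to route d_i units when its total on arcs leaving s_i is d_i, as in constraint (1), without subtracting flow entering s_i; with net outflow the claim fails when cycles pass through a source. *)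

theory Defs
  imports "HOL-Analysis.Analysis" "Graph_Theory.Pair_Digraph"
begin

text \<open>Commodities are the indices \<open>1, \<dots>, num_comm\<close>; the values of \<open>src\<close>, \<open>snk\<close>, \<open>dem\<close> and
  \<open>weight\<close> at other indices, and of \<open>cap\<close> outside the arcs, play no role.\<close>

record 'v anf =
  graph :: "'v pair_pre_digraph"
  cap :: "'v \<times> 'v \<Rightarrow> real"
  num_comm :: nat
  src :: "nat \<Rightarrow> 'v"
  snk :: "nat \<Rightarrow> 'v"
  dem :: "nat \<Rightarrow> real"
  weight :: "nat \<Rightarrow> real"

abbreviation edges :: "'v anf \<Rightarrow> ('v \<times> 'v) set" where
  "edges I \<equiv> parcs (graph I)"

abbreviation comms :: "'v anf \<Rightarrow> nat set" where
  "comms I \<equiv> {1..num_comm I}"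

definition anf_instance :: "'v anf \<Rightarrow> bool" where
  "anf_instance I \<longleftrightarrow>
     pair_fin_digraph (graph I) \<and>
     (\<forall>e\<in>edges I. cap I e > 0) \<and>
     (\<forall>i\<in>comms I. src I i \<in> pverts (graph I) \<and> snk I i \<in> pverts (graph I) \<and>
        dem I i > 0 \<and> weight I i > 0)"

definition outflow :: "'v anf \<Rightarrow> ('v \<times> 'v \<Rightarrow> real) \<Rightarrow> 'v \<Rightarrow> real" where
  "outflow I g v = (\<Sum>u | (v, u) \<in> edges I. g (v, u))"

definition inflow :: "'v anf \<Rightarrow> ('v \<times> 'v \<Rightarrow> real) \<Rightarrow> 'v \<Rightarrow> real" where
  "inflow I g v = (\<Sum>u | (u, v) \<in> edges I. g (u, v))"

definition conserved :: "'v anf \<Rightarrow> nat \<Rightarrow> ('v \<times> 'v \<Rightarrow> real) \<Rightarrow> bool" where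
  "conserved I i g \<longleftrightarrow>
     (\<forall>v \<in> pverts (graph I) - {src I i, snk I i}. inflow I g v = outflow I g v)"

text \<open>The amount routed by a flow is its total on the arcs leaving the source, as in the first
  constraint of the compact LP; flow entering the source is not subtracted. With the net amount
  instead, the two LPs would not be equivalent when arcs enter a source: with arcs \<open>(s, v)\<close> and
  \<open>(v, s)\<close> only, and an isolated sink, the compact LP can attain the full weight of the
  commodity with the cycle through \<open>s\<close> and \<open>v\<close>, while no flow would be valid. If no arc enters
  the source, both readings agree (see \<open>valid_flow_into_sink\<close> below).

  Flows are functions on the arc set only, hence the extensional function space.\<close>

definition valid_flows :: "'v anf \<Rightarrow> nat \<Rightarrow> ('v \<times> 'v \<Rightarrow> real) set" where
  "valid_flows I i =
     {g \<in> edges I \<rightarrow>\<^sub>E {0..}.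
        outflow I g (src I i) = dem I i \<and> conserved I i g \<and> (\<forall>e\<in>edges I. g e \<le> cap I e)}"

text \<open>The variables of the packing LP are indexed by pairs of a commodity and a flow valid for it,
  so commodities with equal source, sink and demand still have separate variables.\<close>

definition flow_support :: "'v anf \<Rightarrow> (nat \<Rightarrow> ('v \<times> 'v \<Rightarrow> real) \<Rightarrow> real) \<Rightarrow> nat \<Rightarrow>
    ('v \<times> 'v \<Rightarrow> real) set" where
  "flow_support I y i = {g \<in> valid_flows I i. y i g \<noteq> 0}"

definition packing_feasible :: "'v anf \<Rightarrow> (nat \<Rightarrow> ('v \<times> 'v \<Rightarrow> real) \<Rightarrow> real) \<Rightarrow> bool" where
  "packing_feasible I y \<longleftrightarrow>
     (\<forall>i\<in>comms I. finite (flow_support I y i)) \<and>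
     (\<forall>i\<in>comms I. (\<Sum>g\<in>flow_support I y i. y i g) \<le> 1) \<and>
     (\<forall>e\<in>edges I. (\<Sum>i\<in>comms I. \<Sum>g\<in>flow_support I y i. g e * y i g) \<le> cap I e) \<and>
     (\<forall>i\<in>comms I. \<forall>g\<in>valid_flows I i. y i g \<ge> 0)"

definition packing_value :: "'v anf \<Rightarrow> (nat \<Rightarrow> ('v \<times> 'v \<Rightarrow> real) \<Rightarrow> real) \<Rightarrow> real" where
  "packing_value I y = (\<Sum>i\<in>comms I. weight I i * (\<Sum>g\<in>flow_support I y i. y i g))"

definition compact_feasible ::
    "'v anf \<Rightarrow> (nat \<Rightarrow> real) \<Rightarrow> (nat \<Rightarrow> 'v \<times> 'v \<Rightarrow> real) \<Rightarrow> bool" where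
  "compact_feasible I f h \<longleftrightarrow>
     (\<forall>i\<in>comms I. outflow I (h i) (src I i) = f i) \<and>
     (\<forall>i\<in>comms I. conserved I i (h i)) \<and>
     (\<forall>e\<in>edges I. (\<Sum>i\<in>comms I. h i e * dem I i) \<le> cap I e) \<and>
     (\<forall>i\<in>comms I. \<forall>e\<in>edges I. h i e * dem I i \<le> f i * cap I e) \<and>
     (\<forall>i\<in>comms I. \<forall>e\<in>edges I. h i e \<ge> 0) \<and>
     (\<forall>i\<in>comms I. f i \<in> {0..1})"

definition compact_value :: "'v anf \<Rightarrow> (nat \<Rightarrow> real) \<Rightarrow> real" where
  "compact_value I f = (\<Sum>i\<in>comms I. weight I i * f i)"

lemma valid_flow_into_sink:
  assumes I: "anf_instance I" and i: "i \<in> comms I" and g: "g \<in> valid_flows I i"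
    and ne: "src I i \<noteq> snk I i" and no_in: "\<forall>u. (u, src I i) \<notin> edges I"
  shows "outflow I g (src I i) - inflow I g (src I i) = dem I i"
    and "inflow I g (snk I i) - outflow I g (snk I i) = dem I i"
proof -
  interpret G: pair_fin_digraph "graph I" using I by (simp add: anf_instance_def)
  let ?V = "pverts (graph I)" and ?s = "src I i" and ?t = "snk I i"
  have fV: "finite ?V" and fE: "finite (edges I)"
    by (fact G.pair_finite_verts, fact G.pair_finite_arcs)
  have st: "?s \<in> ?V" "?t \<in> ?V" using I i by (auto simp: anf_instance_def)
  have out: "outflow I g v = sum g {e \<in> edges I. fst e = v}" for v
    unfolding outflow_def
    by (rule sum.reindex_bij_witness[where i = snd and j = "\<lambda>u. (v, u)"]) auto
  have inn: "inflow I g v = sum g {e \<in> edges I. snd e = v}" for v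
    unfolding inflow_def
    by (rule sum.reindex_bij_witness[where i = fst and j = "\<lambda>u. (u, v)"]) auto
  have "(\<Sum>v\<in>?V. outflow I g v) = sum g (edges I)"
    unfolding out using fV fE by (intro sum.group) (auto dest: G.in_arcsD1)
  moreover have "(\<Sum>v\<in>?V. inflow I g v) = sum g (edges I)"
    unfolding inn using fV fE by (intro sum.group) (auto dest: G.in_arcsD2)
  ultimately have "(\<Sum>v\<in>?V. inflow I g v - outflow I g v) = 0"
    by (simp add: sum_subtractf)
  moreover have "(\<Sum>v\<in>?V. inflow I g v - outflow I g v) =
      (\<Sum>v\<in>{?s, ?t}. inflow I g v - outflow I g v)"
    using st g fV by (intro sum.mono_neutral_right) (auto simp: valid_flows_def conserved_def)
  moreover have "inflow I g ?s = 0" using no_in by (simp add: inflow_def)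
  moreover have "outflow I g ?s = dem I i" using g by (simp add: valid_flows_def)
  ultimately show "outflow I g ?s - inflow I g ?s = dem I i"
    and "inflow I g ?t - outflow I g ?t = dem I i" using ne by auto
qed

end

theory Submission
  imports Defs
begin

text \<open>A compact solution is turned into a packing one by putting, for each commodity \<open>i\<close> with
  \<open>f\<^sub>i > 0\<close>, the weight \<open>f\<^sub>i\<close> on the single flow \<open>e \<mapsto> h\<^sub>i e d\<^sub>i / f\<^sub>i\<close>, which respects the
  capacities by constraint (4). Conversely, averaging the flows of a packing solution with the
  weights \<open>y\<close> and dividing by \<open>d\<^sub>i\<close> gives a compact solution.\<close>

text \<open>Elements of \<open>valid_flows\<close> are extensional, so a flow given by a formula
  must be cut down to the arcs before it can be valid. Balances at a vertex read arc values only and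
  do not notice the cut.\<close>

lemma outflow_restrict: "outflow I (restrict g (edges I)) v = outflow I g v"
  and inflow_restrict: "inflow I (restrict g (edges I)) v = inflow I g v"
  by (auto simp: outflow_def inflow_def intro: sum.cong)

text \<open>Linearity of the flow balances: it lets source amounts and conservation pass through the
  rescaling in both conversions, and through the averaging of flows.\<close>

lemma outflow_scale: "outflow I (\<lambda>e. c * g e) v = c * outflow I g v"
  and inflow_scale: "inflow I (\<lambda>e. c * g e) v = c * inflow I g v"
  by (simp_all add: outflow_def inflow_def sum_distrib_left)

lemma outflow_sum: "outflow I (\<lambda>e. \<Sum>x\<in>S. g x e) v = (\<Sum>x\<in>S. outflow I (g x) v)"
  and inflow_sum: "inflow I (\<lambda>e. \<Sum>x\<in>S. g x e) v = (\<Sum>x\<in>S. inflow I (g x) v)"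
  unfolding outflow_def inflow_def by (rule sum.swap)+

lemma conserved_restrict: "conserved I i (restrict g (edges I)) \<longleftrightarrow> conserved I i g"
  by (simp add: conserved_def outflow_restrict inflow_restrict)

lemma conserved_scale: "conserved I i g \<Longrightarrow> conserved I i (\<lambda>e. c * g e)"
  by (simp add: conserved_def outflow_scale inflow_scale)

lemma conserved_sum:
  "(\<And>x. x \<in> S \<Longrightarrow> conserved I i (g x)) \<Longrightarrow> conserved I i (\<lambda>e. \<Sum>x\<in>S. g x e)"
  by (simp add: conserved_def outflow_sum inflow_sum)

lemma packing_of_compact:
  fixes I :: "'v anf"
  assumes I: "anf_instance I" and feas: "compact_feasible I f h"
  shows "\<exists>y. packing_feasible I y \<and> packing_value I y = compact_value I f"
proof -
  define G where "G i = restrict (\<lambda>e. dem I i / f i * h i e) (edges I)" for i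
  \<comment> \<open>If \<open>f i = 0\<close>, division by zero makes \<open>G i\<close> the zero
    flow, which is not valid for a commodity with positive demand. This is harmless:
    \<open>y i\<close> then vanishes identically and its support is empty.\<close>
  define y where "y i g = (if g = G i then f i else 0)" for i g
  have d: "dem I i > 0" if "i \<in> comms I" for i
    using I that by (auto simp: anf_instance_def)
  have f01: "0 \<le> f i" "f i \<le> 1" if "i \<in> comms I" for i
    using feas that by (auto simp: compact_feasible_def)
  have h0: "h i e \<ge> 0" if "i \<in> comms I" "e \<in> edges I" for i e
    using feas that by (auto simp: compact_feasible_def)
  have G_valid: "G i \<in> valid_flows I i" if i: "i \<in> comms I" and "f i \<noteq> 0" for i
  proof -
    have pos: "f i > 0" using f01[OF i] that by simp
    have "dem I i / f i * h i e \<le> cap I e" if "e \<in> edges I" for e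
      using feas i that pos by (auto simp: compact_feasible_def field_simps)
    moreover have "outflow I (G i) (src I i) = dem I i"
      using feas i pos unfolding G_def outflow_restrict outflow_scale
      by (simp add: compact_feasible_def)
    moreover have "conserved I i (G i)"
      using feas i unfolding G_def conserved_restrict
      by (intro conserved_scale) (simp add: compact_feasible_def)
    ultimately show ?thesis
      using pos d[OF i] h0[OF i] by (auto simp: valid_flows_def G_def)
  qed
  have supp: "flow_support I y i = (if f i = 0 then {} else {G i})" if "i \<in> comms I" for i
    using G_valid[OF that] by (auto simp: flow_support_def y_def)
  have total: "(\<Sum>g\<in>flow_support I y i. y i g) = f i" if "i \<in> comms I" for i
    using supp[OF that] by (simp add: y_def)
  have "(\<Sum>i\<in>comms I. \<Sum>g\<in>flow_support I y i. g e * y i g) \<le> cap I e"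
    if e: "e \<in> edges I" for e
  proof -
    \<comment> \<open>For \<open>f i \<noteq> 0\<close> the factor \<open>f i\<close> cancels and
      equality holds. For \<open>f i = 0\<close> the left side is an empty sum, and nonnegativity of
      \<open>h\<close> suffices.\<close>
    have "(\<Sum>g\<in>flow_support I y i. g e * y i g) \<le> h i e * dem I i" if "i \<in> comms I" for i
      using supp[OF that] e d[OF that] h0[OF that e] by (simp add: y_def G_def)
    hence "(\<Sum>i\<in>comms I. \<Sum>g\<in>flow_support I y i. g e * y i g) \<le> (\<Sum>i\<in>comms I. h i e * dem I i)"
      by (rule sum_mono)
    also have "\<dots> \<le> cap I e" using feas e by (simp add: compact_feasible_def)
    finally show ?thesis .
  qed
  hence "packing_feasible I y"
    using supp total f01 by (simp add: packing_feasible_def y_def)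
  moreover have "packing_value I y = compact_value I f"
    by (simp add: packing_value_def compact_value_def total)
  ultimately show ?thesis by blast
qed

lemma compact_of_packing:
  fixes I :: "'v anf"
  assumes I: "anf_instance I" and feas: "packing_feasible I y"
  shows "\<exists>f h. compact_feasible I f h \<and> compact_value I f = packing_value I y"
proof -
  define S where "S i = flow_support I y i" for i
  define f where "f i = (\<Sum>g\<in>S i. y i g)" for i
  define h where "h i = (\<lambda>e. 1 / dem I i * (\<Sum>g\<in>S i. y i g * g e))" for i
  have d: "dem I i > 0" if "i \<in> comms I" for i
    using I that by (auto simp: anf_instance_def)
  have S_valid: "g \<in> valid_flows I i" if "g \<in> S i" for g i
    using that by (simp add: S_def flow_support_def)
  have y0: "y i g \<ge> 0" if "i \<in> comms I" "g \<in> S i" for i g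
    using feas that(1) S_valid[OF that(2)] by (simp add: packing_feasible_def)
  \<comment> \<open>The division by the demand is undone, so the joint capacity constraints of the
    two LPs become literally the same.\<close>
  have hd: "h i e * dem I i = (\<Sum>g\<in>S i. g e * y i g)" if "i \<in> comms I" for i e
    using d[OF that] by (simp add: h_def mult.commute)
  have "outflow I (h i) (src I i) = f i" if i: "i \<in> comms I" for i
  proof -
    have "outflow I (h i) (src I i) = 1 / dem I i * (\<Sum>g\<in>S i. y i g * outflow I g (src I i))"
      unfolding h_def outflow_scale outflow_sum ..
    \<comment> \<open>Every flow in the support routes exactly the demand, so this common factor
      cancels and the total weight remains.\<close>
    also have "\<dots> = 1 / dem I i * (\<Sum>g\<in>S i. y i g * dem I i)"
      using S_valid by (simp add: valid_flows_def)
    also have "\<dots> = f i" using d[OF i] by (simp add: f_def flip: sum_distrib_right)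
    finally show ?thesis .
  qed
  moreover have "conserved I i (h i)" for i
    unfolding h_def
    by (intro conserved_scale conserved_sum) (use S_valid in \<open>simp add: valid_flows_def\<close>)
  moreover have "(\<Sum>i\<in>comms I. h i e * dem I i) \<le> cap I e" if "e \<in> edges I" for e
    using feas that hd by (simp add: packing_feasible_def S_def)
  moreover have "h i e * dem I i \<le> f i * cap I e" if "i \<in> comms I" "e \<in> edges I" for i e
  proof -
    \<comment> \<open>Constraint (4) comes from the capacity bound on each single valid flow,
      weighted by \<open>y i g \<ge> 0\<close> and summed, not from the joint capacity
      constraint.\<close>
    have "g e * y i g \<le> y i g * cap I e" if g: "g \<in> S i" for g
      using S_valid[OF g] y0[OF \<open>i \<in> comms I\<close> g] \<open>e \<in> edges I\<close>
      by (subst mult.commute) (auto simp: valid_flows_def intro: mult_left_mono)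
    thus ?thesis using hd[OF that(1)] by (simp add: f_def sum_distrib_right sum_mono)
  qed
  moreover have "h i e \<ge> 0" if "i \<in> comms I" "e \<in> edges I" for i e
  proof -
    have "g e \<ge> 0" if "g \<in> S i" for g
      using S_valid[OF that] \<open>e \<in> edges I\<close> by (auto simp: valid_flows_def)
    thus ?thesis using d[OF that(1)] y0[OF that(1)] by (simp add: h_def sum_nonneg)
  qed
  moreover have "f i \<in> {0..1}" if "i \<in> comms I" for i
    using feas that y0[OF that] by (simp add: packing_feasible_def f_def S_def sum_nonneg)
  ultimately have "compact_feasible I f h"
    unfolding compact_feasible_def by blast
  moreover have "compact_value I f = packing_value I y"
    by (simp add: packing_value_def compact_value_def f_def S_def)
  ultimately show ?thesis by blast
qed

theorem mainTheorem3:
  fixes I :: "'v anf"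
  assumes "anf_instance I"
  shows "(\<forall>f h. compact_feasible I f h \<longrightarrow>
            (\<exists>y. packing_feasible I y \<and> packing_value I y = compact_value I f)) \<and>
         (\<forall>y. packing_feasible I y \<longrightarrow>
            (\<exists>f h. compact_feasible I f h \<and> compact_value I f = packing_value I y))"
  using packing_of_compact[OF assms] compact_of_packing[OF assms] by blast

end
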